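(* Let $n\ge 1$, let $S\subseteq\mathbb{Z}_n\setminus\{0\}$, and let $\Gamma=\mathrm{Circ}(n,S)$ be connected and arc-transitive. Then $\Gamma$ is normal-arc-transitive (that is, $\mathrm{Aut}(\mathbb{Z}_n,S)$ is transitive on $S$) if and only if every element of $S$ has order $n$ in $\mathbb{Z}_n$.
   Context: For $S\subseteq\mathbb{Z}_n\setminus\{0\}$, the circulant (Cayley digraph) $\mathrm{Circ}(n,S)=\mathrm{Cay}(\mathbb{Z}_n,S)$ has vertex set $\mathbb{Z}_n$, with an arc from $v$ to $w$ iff $w-v\in S$. A digraph is arc-transitive if its automorphism group acts transitively on its set of arcs (ordered pairs $(v,w)$ with an arc from $v$ to $w$). It is connected if its underlying undirected graph is connected (for $\mathrm{Circ}(n,S)$ this means $\langle S\rangle=\mathbb{Z}_n$). $\mathrm{Aut}(\mathbb{Z}_n,S)=\{\sigma\in\mathrm{Aut}(\mathbb{Z}_n):\sigma(S)=S\}$. The circulant $\mathrm{Circ}(n,S)$ is called normal-arc-transitive if $\mathrm{Aut}(\mathbb{Z}_n,S)$ acts transitively on $S$. *)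

theory Defs
  imports
    "HOL-Algebra.Bij"
    "HOL-Algebra.Elementary_Groups"
    "HOL-Algebra.Multiplicative_Group"
    "Graph_Theory.Graph_Theory"
begin

definition circulant :: "nat \<Rightarrow> int set \<Rightarrow> (int, int \<times> int) pre_digraph" where
  "circulant n S =
     \<lparr>verts = carrier (integer_mod_group n),
      arcs = {(v, w). v \<in> carrier (integer_mod_group n) \<and> w \<in> carrier (integer_mod_group n) \<and>
                w \<otimes>\<^bsub>integer_mod_group n\<^esub> inv\<^bsub>integer_mod_group n\<^esub> v \<in> S},
      tail = fst,
      head = snd\<rparr>"

definition digraph_automorphisms ::
    "('a, 'b) pre_digraph \<Rightarrow> ('a, 'b, 'a, 'b) digraph_isomorphism set" where
  "digraph_automorphisms G = {h. pre_digraph.digraph_isomorphism G h \<and> app_iso h G = G}"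

definition arc_transitive :: "('a, 'b) pre_digraph \<Rightarrow> bool" where
  "arc_transitive G \<longleftrightarrow>
     (\<forall>a \<in> arcs G. \<forall>b \<in> arcs G. \<exists>h \<in> digraph_automorphisms G. iso_arcs h a = b)"

definition auto_stabilizing :: "('a, 'b) monoid_scheme \<Rightarrow> 'a set \<Rightarrow> ('a \<Rightarrow> 'a) set" where
  "auto_stabilizing G S = {\<sigma> \<in> auto G. \<sigma> ` S = S}"

definition normal_arc_transitive :: "nat \<Rightarrow> int set \<Rightarrow> bool" where
  "normal_arc_transitive n S \<longleftrightarrow>
     (\<forall>s \<in> S. \<forall>t \<in> S. \<exists>\<sigma> \<in> auto_stabilizing (integer_mod_group n) S. \<sigma> s = t)"

text \<open>
  Digraph automorphisms of the graph library carry separate maps on vertices and arcs. Since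
  the arcs of a circulant are ordered pairs of vertices, the vertex map determines the arc map,
  and arc-transitivity agrees with the usual notion in terms of vertex permutations that
  preserve adjacency and non-adjacency.
\<close>

lemma arc_transitive_circulant_iff:
  "arc_transitive (circulant n S) \<longleftrightarrow>
     (\<forall>(v, w) \<in> arcs (circulant n S). \<forall>(v', w') \<in> arcs (circulant n S).
        \<exists>f \<in> Bij (verts (circulant n S)).
          (\<forall>x \<in> verts (circulant n S). \<forall>y \<in> verts (circulant n S).
             (f x, f y) \<in> arcs (circulant n S) \<longleftrightarrow> (x, y) \<in> arcs (circulant n S)) \<and>
          f v = v' \<and> f w = w')"
  (is "_ \<longleftrightarrow> ?R")
proof -
  let ?G = "circulant n S"
  have ht: "tail ?G = fst" "head ?G = snd"
    and sub: "arcs ?G \<subseteq> verts ?G \<times> verts ?G"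
    by (auto simp: circulant_def)
  then have wf: "wf_digraph ?G"
    by unfold_locales auto
  have to_perm: "\<exists>f \<in> Bij (verts ?G).
          (\<forall>x \<in> verts ?G. \<forall>y \<in> verts ?G. (f x, f y) \<in> arcs ?G \<longleftrightarrow> (x, y) \<in> arcs ?G) \<and>
          f v = v' \<and> f w = w'"
    if h: "h \<in> digraph_automorphisms ?G" and e: "(v, w) \<in> arcs ?G" "iso_arcs h (v, w) = (v', w')"
    for h v w v' w'
  proof -
    have iso: "pre_digraph.digraph_isomorphism ?G h" and app: "app_iso h ?G = ?G"
      using h by (auto simp: digraph_automorphisms_def)
    have V: "iso_verts h ` verts ?G = verts ?G" and A: "iso_arcs h ` arcs ?G = arcs ?G"
      and T: "iso_tail h = fst" and H: "iso_head h = snd"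
      using app ht by (metis app_iso_simps)+
    have inj: "inj_on (iso_verts h) (verts ?G)"
      using iso by (simp add: pre_digraph.digraph_isomorphism_def)
    have act: "iso_arcs h (x, y) = (iso_verts h x, iso_verts h y)" if "(x, y) \<in> arcs ?G" for x y
      using iso that by (force simp: pre_digraph.digraph_isomorphism_def T H ht prod_eq_iff)
    have iff: "(iso_verts h x, iso_verts h y) \<in> arcs ?G \<longleftrightarrow> (x, y) \<in> arcs ?G"
      if xy: "x \<in> verts ?G" "y \<in> verts ?G" for x y
    proof
      assume "(iso_verts h x, iso_verts h y) \<in> arcs ?G"
      then obtain p q where pq: "(p, q) \<in> arcs ?G"
        "iso_arcs h (p, q) = (iso_verts h x, iso_verts h y)"
        using A by (metis imageE surj_pair)
      then have "p \<in> verts ?G" "q \<in> verts ?G" "iso_verts h p = iso_verts h x"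
        "iso_verts h q = iso_verts h y"
        using sub act by auto
      then show "(x, y) \<in> arcs ?G"
        using pq inj xy by (metis inj_onD)
    next
      assume "(x, y) \<in> arcs ?G"
      then show "(iso_verts h x, iso_verts h y) \<in> arcs ?G"
        using A act by (metis imageI)
    qed
    have vw: "v \<in> verts ?G" "w \<in> verts ?G"
      using sub e by auto
    show ?thesis
    proof (intro bexI conjI)
      show "restrict (iso_verts h) (verts ?G) \<in> Bij (verts ?G)"
        using inj V by (auto simp: Bij_def bij_betw_def inj_on_def)
    qed (use iff vw act e in auto)
  qed
  have of_perm: "\<exists>h \<in> digraph_automorphisms ?G. iso_arcs h (v, w) = (f v, f w)"
    if f: "f \<in> Bij (verts ?G)"
      and iff: "\<forall>x \<in> verts ?G. \<forall>y \<in> verts ?G. (f x, f y) \<in> arcs ?G \<longleftrightarrow> (x, y) \<in> arcs ?G"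
    for f v w
  proof
    let ?h = "\<lparr>iso_verts = f, iso_arcs = map_prod f f, iso_head = snd, iso_tail = fst\<rparr>"
    have bij: "inj_on f (verts ?G)" "f ` verts ?G = verts ?G"
      using f by (auto simp: Bij_def bij_betw_def)
    have "map_prod f f ` arcs ?G = arcs ?G"
    proof
      show "map_prod f f ` arcs ?G \<subseteq> arcs ?G"
        using sub iff by auto
      show "arcs ?G \<subseteq> map_prod f f ` arcs ?G"
      proof
        fix e assume e: "e \<in> arcs ?G"
        obtain p q where pq: "e = (p, q)"
          by (cases e)
        then have "p \<in> f ` verts ?G" "q \<in> f ` verts ?G"
          using e sub unfolding bij(2) by auto
        then obtain x y where xy: "x \<in> verts ?G" "y \<in> verts ?G" "p = f x" "q = f y"
          by (elim imageE)
        then have "(x, y) \<in> arcs ?G"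
          using iff e pq by simp
        then show "e \<in> map_prod f f ` arcs ?G"
          by (rule rev_image_eqI) (simp add: pq xy)
      qed
    qed
    moreover have "inj_on (map_prod f f) (arcs ?G)"
      using map_prod_inj_on[OF bij(1) bij(1)] sub by (rule inj_on_subset)
    ultimately show "?h \<in> digraph_automorphisms ?G"
      using wf bij ht
      by (simp add: digraph_automorphisms_def pre_digraph.digraph_isomorphism_def app_iso_def)
    show "iso_arcs ?h (v, w) = (f v, f w)"
      by simp
  qed
  show ?thesis
  proof
    assume "arc_transitive ?G"
    then show ?R
      unfolding arc_transitive_def using to_perm by (intro ballI case_prodI2) blast
  next
    assume R: ?R
    show "arc_transitive ?G"
      unfolding arc_transitive_def
    proof (intro ballI)
      fix a b assume ab: "a \<in> arcs ?G" "b \<in> arcs ?G"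
      obtain v w v' w' where eq: "a = (v, w)" "b = (v', w')"
        by (cases a, cases b)
      then obtain f where "f \<in> Bij (verts ?G)"
        and "\<forall>x \<in> verts ?G. \<forall>y \<in> verts ?G. (f x, f y) \<in> arcs ?G \<longleftrightarrow> (x, y) \<in> arcs ?G"
        and "f v = v'" "f w = w'"
        using bspec[OF bspec[OF R ab(1), unfolded eq(1) case_prod_conv] ab(2)] by auto
      then show "\<exists>h \<in> digraph_automorphisms ?G. iso_arcs h a = b"
        using of_perm[of f v w] eq by simp
    qed
  qed
qed

end

theory Submission
  imports Defs "HOL-Number_Theory.Cong"
begin

text \<open>
  If \<open>p\<close> is a prime not dividing \<open>n\<close>, cyclic rotation of the step sequences shows that the number
  of walks of length \<open>p\<close> from \<open>v\<close> to \<open>w\<close> in \<open>Circ(n, S)\<close> is, modulo \<open>p\<close>, the indicator of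
  \<open>w - v \<in> pS\<close>. Since automorphisms preserve walk counts, every automorphism of \<open>Circ(n, S)\<close> is one
  of \<open>Circ(n, pS)\<close>, and hence of \<open>Circ(n, mS)\<close> for all \<open>m\<close> coprime to \<open>n\<close>. If \<open>S\<close> consists of
  generators and \<open>s, t \<in> S\<close>, put \<open>m = t / s\<close>: the set \<open>mS\<close> contains \<open>t\<close> and is invariant under the
  stabilizer of \<open>0\<close>, whose orbit of \<open>t\<close> is \<open>S\<close>; so \<open>mS = S\<close> and multiplication by \<open>m\<close> maps \<open>s\<close>
  to \<open>t\<close>. Conversely, if \<open>Aut(\<int>\<^sub>n, S)\<close> is transitive on \<open>S\<close>, all elements of \<open>S\<close> have the same
  order \<open>r\<close>, and since they generate \<open>\<int>\<^sub>n\<close>, \<open>r\<close> annihilates \<open>\<int>\<^sub>n\<close>.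
\<close>

section \<open>Fixed points of a map whose \<open>p\<close>-th power is the identity\<close>

lemma funpow_funpow_apply: "(f ^^ a) ((f ^^ b) x) = (f ^^ (a + b)) x"
  by (simp add: funpow_add)

lemma funpow_mult_fixpoint:
  assumes "(f ^^ a) x = x"
  shows "(f ^^ (a * k)) x = x"
proof -
  have "((f ^^ a) ^^ k) x = x"
    by (induction k) (simp_all add: assms)
  then show ?thesis
    by (simp add: funpow_mult mult.commute)
qed

text \<open>By Bezout, the gcd is a multiple of \<open>a\<close> minus a multiple of
  \<open>b\<close>, and both of those iterates fix \<open>x\<close>. Over the naturals this requires
  \<open>a\<close> nonzero, hence the case split.\<close>

lemma funpow_gcd_fixpoint:
  assumes "(f ^^ a) x = x" and "(f ^^ b) x = x"
  shows "(f ^^ gcd a b) x = x"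
proof (cases "a = 0")
  case False
  then obtain i j where ij: "a * i = b * j + gcd a b"
    using bezout_nat by blast
  have "(f ^^ gcd a b) x = (f ^^ gcd a b) ((f ^^ (b * j)) x)"
    using assms(2) by (simp add: funpow_mult_fixpoint)
  also have "\<dots> = (f ^^ (a * i)) x"
    by (simp only: ij funpow_funpow_apply add.commute)
  finally show ?thesis
    using assms(1) by (simp add: funpow_mult_fixpoint)
qed (use assms in simp)

text \<open>The iterates of \<open>f\<close> act on \<open>A\<close> as a cyclic group of order
  dividing \<open>p\<close>. As \<open>p\<close> is prime, an orbit has either one element or
  exactly \<open>p\<close>, and the latter vanish modulo \<open>p\<close>.\<close>

lemma card_cong_card_fixpoints:
  assumes "finite A" and "f ` A \<subseteq> A" and "prime p" and pow: "\<And>x. x \<in> A \<Longrightarrow> (f ^^ p) x = x"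
  shows "[card A = card {x \<in> A. f x = x}] (mod p)"
proof -
  define B where "B = {x \<in> A. f x \<noteq> x}"
  define orb where "orb x = (\<lambda>k. (f ^^ k) x) ` {..<p}" for x
  have p0: "p > 0"
    using \<open>prime p\<close> prime_gt_0_nat by blast
  have closed: "(f ^^ k) x \<in> A" if "x \<in> A" for k x
    using that assms(2) by (induction k) auto
  have mod_p: "(f ^^ k) x = (f ^^ (k mod p)) x" if "x \<in> A" for k x
  proof -
    have "(f ^^ k) x = (f ^^ (k mod p)) ((f ^^ (p * (k div p))) x)"
      by (simp add: funpow_funpow_apply)
    then show ?thesis
      using pow[OF that] by (simp add: funpow_mult_fixpoint)
  qed
  have mem_orb: "y \<in> orb x \<longleftrightarrow> (\<exists>k. y = (f ^^ k) x)" if "x \<in> A" for x y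
  proof
    assume "\<exists>k. y = (f ^^ k) x"
    then obtain k where "y = (f ^^ (k mod p)) x"
      using mod_p \<open>x \<in> A\<close> by blast
    then show "y \<in> orb x"
      using p0 by (auto simp: orb_def)
  qed (auto simp: orb_def)
  have return: "\<exists>j. x = (f ^^ j) ((f ^^ k) x)" if "x \<in> A" for x k
  proof
    \<comment> \<open>Adding \<open>k * (p - 1)\<close> to \<open>k\<close> gives the full multiple
      \<open>p * k\<close>, so this iterate undoes \<open>f ^^ k\<close>.\<close>
    have "(f ^^ (k * (p - 1))) ((f ^^ k) x) = (f ^^ (p * k)) x"
      using p0 by (cases p) (simp_all add: funpow_funpow_apply algebra_simps)
    then show "x = (f ^^ (k * (p - 1))) ((f ^^ k) x)"
      using pow[OF that] by (simp add: funpow_mult_fixpoint)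
  qed
  have orb_eq: "orb y = orb x" if xy: "x \<in> A" "y \<in> orb x" for x y
  proof -
    obtain k where k: "y = (f ^^ k) x"
      using xy mem_orb by blast
    obtain j where j: "x = (f ^^ j) y"
      using return[OF xy(1)] k by auto
    have "y \<in> A"
      using closed xy(1) k by auto
    have "z \<in> orb y \<longleftrightarrow> z \<in> orb x" for z
      unfolding mem_orb[OF \<open>y \<in> A\<close>] mem_orb[OF \<open>x \<in> A\<close>]
      by (metis funpow_funpow_apply j k)
    then show ?thesis
      by blast
  qed
  have fixed: "f x = x" if "x \<in> A" "(f ^^ d) x = x" "0 < d" "d < p" for x d
  proof -
    have "gcd d p = 1"
      using that \<open>prime p\<close> by (metis coprime_iff_gcd_eq_1 coprime_commute nat_dvd_not_less prime_imp_coprime)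
    then show ?thesis
      using funpow_gcd_fixpoint[OF that(2) pow[OF that(1)]] by simp
  qed
  have card_orb: "card (orb x) = p" if "x \<in> B" for x
  proof -
    have xA: "x \<in> A" and nfix: "f x \<noteq> x"
      using that by (auto simp: B_def)
    have neq: "(f ^^ i) x \<noteq> (f ^^ j) x" if "i < j" "j < p" for i j
    proof
      assume eq: "(f ^^ i) x = (f ^^ j) x"
      \<comment> \<open>The iterate \<open>p - i\<close> leads from \<open>(f ^^ i) x\<close> back
        to \<open>x\<close>. It cancels \<open>f ^^ i\<close> from the coincidence and leaves
        \<open>x\<close> fixed by \<open>f ^^ (j - i)\<close>, where
        \<open>0 < j - i < p\<close>.\<close>
      have "(f ^^ (j - i)) x = (f ^^ (j - i)) ((f ^^ (p - i)) ((f ^^ i) x))"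
        using pow[OF xA] that by (simp add: funpow_funpow_apply)
      also have "\<dots> = (f ^^ (p - i)) ((f ^^ (j - i)) ((f ^^ i) x))"
        by (simp only: funpow_funpow_apply ac_simps)
      also have "(f ^^ (j - i)) ((f ^^ i) x) = (f ^^ i) x"
        using that unfolding funpow_funpow_apply by (simp add: eq)
      also have "(f ^^ (p - i)) ((f ^^ i) x) = x"
        using pow[OF xA] that by (simp add: funpow_funpow_apply)
      finally show False
        using fixed[OF xA, of "j - i"] nfix that by (simp add: less_imp_diff_less)
    qed
    have "inj_on (\<lambda>k. (f ^^ k) x) {..<p}"
      by (rule linorder_inj_onI') (use neq in auto)
    then show ?thesis
      by (simp add: orb_def card_image)
  qed
  have orb_B: "orb x \<subseteq> B" if "x \<in> B" for x
  proof
    fix y assume y: "y \<in> orb x"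
    have xA: "x \<in> A"
      using that by (simp add: B_def)
    then have yA: "y \<in> A"
      using y closed by (auto simp: orb_def)
    have "f y \<noteq> y"
    proof
      assume fy: "f y = y"
      \<comment> \<open>A fixed point has a singleton orbit, whereas \<open>orb y = orb x\<close>
        has \<open>p > 1\<close> elements.\<close>
      have "(f ^^ k) y = y" for k
        by (induction k) (simp_all add: fy)
      then have "orb y \<subseteq> {y}"
        by (auto simp: orb_def)
      then have "card (orb y) \<le> card {y}"
        by (intro card_mono) simp_all
      then show False
        using card_orb[OF that] orb_eq[OF xA y] prime_gt_1_nat[OF \<open>prime p\<close>] by simp
    qed
    then show "y \<in> B"
      using yA by (simp add: B_def)
  qed
  have self: "x \<in> orb x" if "x \<in> A" for x
    using mem_orb[OF that] by (metis funpow_0)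
  have cover: "\<Union> (orb ` B) = B"
    using orb_B self by (auto simp: B_def)
  have "finite B"
    using \<open>finite A\<close> by (simp add: B_def)
  have "p dvd card (\<Union> (orb ` B))"
  proof (rule dvd_partition)
    show "finite (\<Union> (orb ` B))"
      using cover \<open>finite B\<close> by simp
    show "\<forall>c\<in>orb ` B. p dvd card c"
      using card_orb by simp
    show "\<forall>c1\<in>orb ` B. \<forall>c2\<in>orb ` B. c1 \<noteq> c2 \<longrightarrow> c1 \<inter> c2 = {}"
    proof (intro ballI impI)
      fix c1 c2 assume c: "c1 \<in> orb ` B" "c2 \<in> orb ` B" and "c1 \<noteq> c2"
      have "orb z = c" if "z \<in> c" "c \<in> orb ` B" for c z
        using that orb_eq by (auto simp: B_def)
      with c \<open>c1 \<noteq> c2\<close> show "c1 \<inter> c2 = {}"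
        by blast
    qed
  qed
  then have "p dvd card B"
    by (simp add: cover)
  moreover have "card A = card B + card {x \<in> A. f x = x}"
  proof -
    have "card (B \<union> {x \<in> A. f x = x}) = card B + card {x \<in> A. f x = x}"
      using \<open>finite A\<close> \<open>finite B\<close> by (intro card_Un_disjoint) (auto simp: B_def)
    moreover have "B \<union> {x \<in> A. f x = x} = A"
      by (auto simp: B_def)
    ultimately show ?thesis
      by simp
  qed
  ultimately show ?thesis
    by (auto simp: cong_def)
qed

section \<open>Counting walks by their step sequences, modulo a prime\<close>

lemma rotate1_fixpoint_eq_replicate:
  assumes "rotate1 xs = xs"
  shows "xs = replicate (length xs) (hd xs)"
proof (rule nth_equalityI)
  fix i assume i: "i < length xs"
  \<comment> \<open>The head of the \<open>i\<close>-fold rotation is entry \<open>i\<close>, so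
    every entry equals the head.\<close>
  have "rotate i xs = xs"
    by (induction i) (simp_all add: assms)
  then have "xs ! i = hd xs"
    using hd_rotate_conv_nth[of xs i] i by force
  then show "xs ! i = replicate (length xs) (hd xs) ! i"
    using i by simp
qed simp

text \<open>Walks are recorded by their steps, not their vertices: reordering the steps keeps both
  endpoints because the sum is unchanged, so cyclic rotation acts on the walks from \<open>v\<close>
  to \<open>w\<close>.\<close>

definition step_walks :: "nat \<Rightarrow> int set \<Rightarrow> nat \<Rightarrow> int \<Rightarrow> int \<Rightarrow> int list set" where
  "step_walks n S k v w = {xs. length xs = k \<and> set xs \<subseteq> S \<and> (v + sum_list xs) mod int n = w}"

text \<open>Automorphisms of the circulant as maps on residues; values outside
  \<open>{0..<int n}\<close> are left free.\<close>

definition circulant_perm :: "nat \<Rightarrow> int set \<Rightarrow> (int \<Rightarrow> int) \<Rightarrow> bool" where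
  "circulant_perm n S f \<longleftrightarrow> bij_betw f {0..<int n} {0..<int n} \<and>
     (\<forall>x \<in> {0..<int n}. \<forall>y \<in> {0..<int n}. (f y - f x) mod int n \<in> S \<longleftrightarrow> (y - x) mod int n \<in> S)"

lemma finite_step_walks:
  assumes "finite S"
  shows "finite (step_walks n S k v w)"
  by (rule finite_subset[OF _ finite_lists_length_eq[OF assms, of k]]) (auto simp: step_walks_def)

text \<open>Splits off the first step, then sums over the vertex \<open>u\<close> it reaches rather
  than over the step itself, since automorphisms act on vertices.\<close>

lemma card_step_walks_Suc:
  assumes "n > 0" and S: "S \<subseteq> {0..<int n}"
  shows "card (step_walks n S (Suc k) v w) =
    (\<Sum>u | u \<in> {0..<int n} \<and> (u - v) mod int n \<in> S. card (step_walks n S k u w))"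
proof -
  have fin: "finite S"
    using S finite_subset by blast
  have shift: "step_walks n S k ((v + s) mod int n) w = step_walks n S k (v + s) w" for s
    by (simp add: step_walks_def mod_add_left_eq)
  have "step_walks n S (Suc k) v w = (\<Union>s\<in>S. (#) s ` step_walks n S k (v + s) w)"
    by (auto simp: step_walks_def length_Suc_conv add.assoc image_iff)
  then have "card (step_walks n S (Suc k) v w) = (\<Sum>s\<in>S. card ((#) s ` step_walks n S k (v + s) w))"
    using fin finite_step_walks[OF fin] by (simp only:) (rule card_UN_disjoint; auto)
  also have "\<dots> = (\<Sum>s\<in>S. card (step_walks n S k ((v + s) mod int n) w))"
    by (simp add: card_image shift)
  also have "\<dots> = (\<Sum>u | u \<in> {0..<int n} \<and> (u - v) mod int n \<in> S. card (step_walks n S k u w))"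
  proof (rule sum.reindex_bij_witness[where j = "\<lambda>s. (v + s) mod int n" and i = "\<lambda>u. (u - v) mod int n"])
    fix s assume "s \<in> S"
    then have "s mod int n = s"
      using S by auto
    then show "((v + s) mod int n - v) mod int n = s"
      by (simp add: mod_diff_left_eq)
    with \<open>s \<in> S\<close> show "(v + s) mod int n \<in> {u. u \<in> {0..<int n} \<and> (u - v) mod int n \<in> S}"
      using \<open>n > 0\<close> by simp
  next
    fix u assume "u \<in> {u. u \<in> {0..<int n} \<and> (u - v) mod int n \<in> S}"
    then show "(v + (u - v) mod int n) mod int n = u" and "(u - v) mod int n \<in> S"
      by (simp_all add: mod_add_right_eq)
  qed simp
  finally show ?thesis .
qed

lemma bij_betw_restrict_Collect:
  assumes "bij_betw f A B" and "\<And>x. x \<in> A \<Longrightarrow> Q (f x) \<longleftrightarrow> P x"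
  shows "bij_betw f {x \<in> A. P x} {y \<in> B. Q y}"
proof (rule bij_betw_subset[OF assms(1)])
  show "f ` {x \<in> A. P x} = {y \<in> B. Q y}"
    using assms by (auto simp: bij_betw_def image_iff)
qed auto

text \<open>Induction on the length: \<open>f\<close> maps the out-neighbours of \<open>v\<close>
  bijectively onto those of \<open>f v\<close>, so the two first-step recursions match term by
  term.\<close>

lemma card_step_walks_invariant:
  assumes "n > 0" and S: "S \<subseteq> {0..<int n}" and f: "circulant_perm n S f"
    and "v \<in> {0..<int n}" and w: "w \<in> {0..<int n}"
  shows "card (step_walks n S k (f v) (f w)) = card (step_walks n S k v w)"
  using \<open>v \<in> {0..<int n}\<close>
proof (induction k arbitrary: v)
  have bij: "bij_betw f {0..<int n} {0..<int n}"
    and iff: "\<And>x y. x \<in> {0..<int n} \<Longrightarrow> y \<in> {0..<int n} \<Longrightarrow>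
      (f y - f x) mod int n \<in> S \<longleftrightarrow> (y - x) mod int n \<in> S"
    using f by (auto simp: circulant_perm_def)
  {
    case 0
    \<comment> \<open>Without steps the count is 1 or 0 according to whether the start, reduced
      modulo \<open>n\<close>, is the end; so \<open>f v\<close> has to be a residue
      already.\<close>
    have "f v \<in> {0..<int n}"
      using bij 0 by (rule bij_betwE[THEN bspec])
    then have "f v mod int n = f v" and "v mod int n = v"
      using 0 by auto
    moreover have "f v = f w \<longleftrightarrow> v = w"
      using bij 0 w by (auto simp: bij_betw_def inj_on_def)
    ultimately show ?case
      by (simp add: step_walks_def cong: conj_cong)
  next
    case (Suc k)
    have "bij_betw f {u \<in> {0..<int n}. (u - v) mod int n \<in> S}
        {u \<in> {0..<int n}. (u - f v) mod int n \<in> S}"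
      using bij iff[OF Suc.prems] by (rule bij_betw_restrict_Collect) simp_all
    then have "(\<Sum>u | u \<in> {0..<int n} \<and> (u - f v) mod int n \<in> S. card (step_walks n S k u (f w))) =
        (\<Sum>u | u \<in> {0..<int n} \<and> (u - v) mod int n \<in> S. card (step_walks n S k (f u) (f w)))"
      by (rule sum.reindex_bij_betw[symmetric])
    also have "\<dots> = (\<Sum>u | u \<in> {0..<int n} \<and> (u - v) mod int n \<in> S. card (step_walks n S k u w))"
      using Suc.IH by (intro sum.cong) auto
    finally show ?case
      using assms by (simp only: card_step_walks_Suc)
  }
qed

lemma mult_mod_inj_on:
  fixes m :: int
  assumes "coprime m (int n)"
  shows "inj_on (\<lambda>s. (m * s) mod int n) {0..<int n}"
proof (rule inj_onI)
  fix x y assume xy: "x \<in> {0..<int n}" "y \<in> {0..<int n}" "(m * x) mod int n = (m * y) mod int n"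
  then have "[m * x = m * y] (mod int n)"
    by (simp add: cong_def)
  then have "[x = y] (mod int n)"
    using assms cong_mult_lcancel by blast
  then show "x = y"
    using xy by (simp add: cong_def)
qed

text \<open>Rotation permutes these walks, and those it fixes repeat a single step \<open>s\<close>,
  with displacement \<open>p * s\<close>. As \<open>p\<close> is invertible modulo \<open>n\<close>,
  at most one \<open>s\<close> fits.\<close>

lemma card_step_walks_cong_prime:
  assumes S: "S \<subseteq> {0..<int n}" and p: "prime p" "coprime p n" and w: "w \<in> {0..<int n}"
  shows "[card (step_walks n S p v w) =
    (if (w - v) mod int n \<in> (\<lambda>s. (int p * s) mod int n) ` S then 1 else 0)] (mod p)"
proof -
  let ?mul = "\<lambda>s. (int p * s) mod int n"
  define T where "T = {s \<in> S. ?mul s = (w - v) mod int n}"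
  have "finite S"
    using S finite_subset by blast
  have sum_rot: "sum_list (rotate1 xs) = sum_list xs" for xs :: "int list"
    by (cases xs) simp_all
  have "[card (step_walks n S p v w) = card {xs \<in> step_walks n S p v w. rotate1 xs = xs}] (mod p)"
  proof (rule card_cong_card_fixpoints)
    show "rotate1 ` step_walks n S p v w \<subseteq> step_walks n S p v w"
      by (auto simp: step_walks_def sum_rot)
    show "(rotate1 ^^ p) xs = xs" if "xs \<in> step_walks n S p v w" for xs
      using that by (auto simp: step_walks_def simp flip: rotate_def)
  qed (use p \<open>finite S\<close> in \<open>auto intro: finite_step_walks\<close>)
  moreover have walk_iff: "replicate p s \<in> step_walks n S p v w \<longleftrightarrow> s \<in> T" for s
  proof -
    have "(v + int p * s) mod int n = w \<longleftrightarrow> [v + int p * s = w] (mod int n)"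
      using w by (simp add: cong_def)
    also have "\<dots> \<longleftrightarrow> [int p * s = w - v] (mod int n)"
      by (simp add: cong_iff_dvd_diff algebra_simps)
    finally show ?thesis
      using prime_gt_0_nat[OF p(1)] by (auto simp: step_walks_def T_def sum_list_replicate cong_def)
  qed
  moreover have "{xs \<in> step_walks n S p v w. rotate1 xs = xs} = replicate p ` T"
  proof (intro equalityI subsetI)
    fix xs assume xs: "xs \<in> {xs \<in> step_walks n S p v w. rotate1 xs = xs}"
    then have "xs = replicate p (hd xs)"
      using rotate1_fixpoint_eq_replicate[of xs] by (simp add: step_walks_def)
    with xs show "xs \<in> replicate p ` T"
      using walk_iff by (metis (no_types, lifting) imageI mem_Collect_eq)
  qed (use walk_iff in auto)
  moreover have "card (replicate p ` T) = card T"
    using prime_gt_0_nat[OF p(1)] by (intro card_image inj_onI) (metis hd_replicate less_numeral_extra(3))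
  moreover have "card T = (if (w - v) mod int n \<in> ?mul ` S then 1 else 0)"
  proof (cases "(w - v) mod int n \<in> ?mul ` S")
    case True
    then obtain s where s: "s \<in> S" "?mul s = (w - v) mod int n"
      by auto
    have "inj_on ?mul S"
      using mult_mod_inj_on[of "int p" n] p(2) S by (auto intro: inj_on_subset)
    then have "T = {s}"
      using s by (auto simp: T_def inj_on_def)
    then show ?thesis
      using True by simp
  next
    case False
    then have "T = {}"
      by (force simp: T_def)
    then show ?thesis
      using False by simp
  qed
  ultimately show ?thesis
    by simp
qed

section \<open>Multiples of the connection set\<close>

text \<open>The two membership indicators are congruent modulo \<open>p\<close> to equal walk
  counts, and 0 and 1 are not congruent modulo a prime.\<close>

lemma circulant_perm_mult_prime:
  assumes "n > 0" and S: "S \<subseteq> {0..<int n}" and f: "circulant_perm n S f"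
    and p: "prime p" "coprime p n"
  shows "circulant_perm n ((\<lambda>s. (int p * s) mod int n) ` S) f"
proof -
  let ?P = "(\<lambda>s. (int p * s) mod int n) ` S"
  have bij: "bij_betw f {0..<int n} {0..<int n}"
    using f by (simp add: circulant_perm_def)
  have "(f y - f x) mod int n \<in> ?P \<longleftrightarrow> (y - x) mod int n \<in> ?P"
    if xy: "x \<in> {0..<int n}" "y \<in> {0..<int n}" for x y
  proof -
    have "f y \<in> {0..<int n}"
      using bij xy(2) by (rule bij_betwE[THEN bspec])
    then have "[(if (f y - f x) mod int n \<in> ?P then 1 else 0) =
        (if (y - x) mod int n \<in> ?P then 1 else 0 :: nat)] (mod p)"
      using card_step_walks_cong_prime[OF S p, of "f y" "f x"] card_step_walks_cong_prime[OF S p xy(2), of x]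
        card_step_walks_invariant[OF assms(1-3) xy, of p]
      by (metis cong_sym cong_trans)
    then show ?thesis
      using prime_gt_1_nat[OF p(1)]
      by (cases "(f y - f x) mod int n \<in> ?P"; cases "(y - x) mod int n \<in> ?P")
        (simp_all only: if_True if_False, simp_all add: cong_def)
  qed
  then show ?thesis
    using bij by (simp add: circulant_perm_def)
qed

text \<open>Schur's theorem on multipliers.\<close>

lemma circulant_perm_mult:
  assumes "n > 0" and "S \<subseteq> {0..<int n}" and "circulant_perm n S f" and "m > 0" and "coprime m n"
  shows "circulant_perm n ((\<lambda>s. (int m * s) mod int n) ` S) f"
  using \<open>m > 0\<close> \<open>coprime m n\<close>
proof (induction m rule: prime_divisors_induct)
  case (unit m)
  have "(\<lambda>s. (int m * s) mod int n) ` S = (\<lambda>s. s) ` S"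
    using assms(2) unit by (intro image_cong) auto
  then show ?case
    using assms(3) by simp
next
  case (factor p m)
  \<comment> \<open>The prime case is applied to the set \<open>mS\<close>, of whose circulant
    \<open>f\<close> is an automorphism by induction.\<close>
  have "circulant_perm n ((\<lambda>s. (int p * s) mod int n) ` (\<lambda>s. (int m * s) mod int n) ` S) f"
  proof (rule circulant_perm_mult_prime)
    show "circulant_perm n ((\<lambda>s. (int m * s) mod int n) ` S) f"
      using factor by auto
  qed (use factor assms(1) in auto)
  moreover have "(\<lambda>s. (int p * s) mod int n) ` (\<lambda>s. (int m * s) mod int n) ` S =
      (\<lambda>s. (int (p * m) * s) mod int n) ` S"
    by (simp add: image_image mod_mult_right_eq mult.assoc)
  ultimately show ?case
    by simp
qed simp

section \<open>Arcs, group automorphisms, orders and connectedness in residue arithmetic\<close>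

lemma arcs_circulant:
  assumes "n > 0"
  shows "(v, w) \<in> arcs (circulant n S) \<longleftrightarrow>
    v \<in> {0..<int n} \<and> w \<in> {0..<int n} \<and> (w - v) mod int n \<in> S"
proof -
  have "(w + - v mod int n) mod int n = (w - v) mod int n"
    by (simp add: mod_add_right_eq)
  then show ?thesis
    using assms inv_integer_mod_group[of v n] by (auto simp: circulant_def carrier_integer_mod_group)
qed

text \<open>The map is restricted to the residues because \<open>auto\<close>, through
  \<open>Bij\<close>, admits only extensional functions.\<close>

lemma mult_mod_auto:
  assumes "n > 0" and "coprime m (int n)"
  shows "(\<lambda>x \<in> {0..<int n}. (m * x) mod int n) \<in> auto (integer_mod_group n)"
proof -
  let ?f = "\<lambda>x. (m * x) mod int n" and ?V = "{0..<int n}"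
  have V: "carrier (integer_mod_group n) = ?V"
    using assms by (simp add: carrier_integer_mod_group)
  have "?f ` ?V \<subseteq> ?V"
    using assms(1) by auto
  then have "bij_betw ?f ?V ?V"
    using mult_mod_inj_on[OF assms(2)] by (simp add: bij_betw_def endo_inj_surj)
  then have "bij_betw (restrict ?f ?V) ?V ?V"
    by (subst bij_betw_cong[where g = ?f]) simp_all
  moreover have "restrict ?f ?V \<in> hom (integer_mod_group n) (integer_mod_group n)"
    using assms(1) by (auto simp: hom_def V mod_add_eq mod_mult_right_eq distrib_left)
  ultimately show ?thesis
    by (simp add: auto_def Bij_def V)
qed

lemma ord_integer_mod_group_eq_iff:
  assumes "n > 0" and "s \<in> carrier (integer_mod_group n)"
  shows "group.ord (integer_mod_group n) s = n \<longleftrightarrow> coprime s (int n)"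
proof -
  have "group.ord (integer_mod_group n) s = n \<longleftrightarrow> (\<forall>k::nat. int n dvd int k * s \<longleftrightarrow> n dvd k)"
    using group.ord_unique[OF group_integer_mod_group assms(2), of n] by (simp add: dvd_eq_mod_eq_0)
  also have "\<dots> \<longleftrightarrow> coprime s (int n)"
  proof
    assume dvd: "\<forall>k::nat. int n dvd int k * s \<longleftrightarrow> n dvd k"
    define d where "d = nat (gcd s (int n))"
    have d: "int d dvd s" "int d dvd int n" "d > 0"
      using \<open>n > 0\<close> by (simp_all add: d_def)
    then obtain e where e: "n = d * e"
      by auto
    \<comment> \<open>The cofactor \<open>e\<close> of the gcd annihilates \<open>s\<close>, so
      \<open>n\<close> divides \<open>e\<close>; as \<open>n = d * e\<close>, this forces
      \<open>d = 1\<close>.\<close>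
    have "int n dvd int e * s"
      using d(1) e by (auto simp: mult.commute mult_dvd_mono)
    then have "n dvd e"
      using dvd by blast
    then have "d = 1"
      using e \<open>n > 0\<close> by (auto dest: dvd_imp_le)
    then show "coprime s (int n)"
      by (simp add: d_def nat_eq_iff coprime_iff_gcd_eq_1)
  next
    assume "coprime s (int n)"
    then show "\<forall>k::nat. int n dvd int k * s \<longleftrightarrow> n dvd k"
      by (simp add: coprime_commute coprime_dvd_mult_left_iff)
  qed
  finally show ?thesis .
qed

text \<open>Along an arc in either direction \<open>r * x\<close> is constant modulo
  \<open>n\<close>. It vanishes at 0, hence by connectedness at every vertex, in particular at the
  residue of 1.\<close>

lemma connected_circulant_annihilator:
  assumes "n > 0" and conn: "Digraph_Component.connected (circulant n S)"
    and ann: "\<And>s. s \<in> S \<Longrightarrow> int n dvd r * s"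
  shows "int n dvd r"
proof -
  let ?G = "mk_symmetric (circulant n S)"
  have parc: "int n dvd r * (y - x)" if "(x, y) \<in> parcs ?G" for x y
  proof -
    have arc: "int n dvd r * (w - v)" if "(v, w) \<in> arcs (circulant n S)" for v w
    proof -
      have "int n dvd r * ((w - v) mod int n)"
        using ann that by (simp add: arcs_circulant[OF \<open>n > 0\<close>])
      then show ?thesis
        by (simp add: dvd_eq_mod_eq_0 mod_mult_right_eq)
    qed
    have ht: "tail (circulant n S) = fst" "head (circulant n S) = snd"
      by (simp_all add: circulant_def)
    from that consider "(x, y) \<in> arcs (circulant n S)" | "(y, x) \<in> arcs (circulant n S)"
      by (auto simp: parcs_mk_symmetric ht)
    then show ?thesis
      using arc by cases (metis dvd_minus_iff minus_diff_eq mult_minus_right)+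
  qed
  \<comment> \<open>Reducing 1 covers \<open>n = 1\<close>, where 0 is the only vertex.\<close>
  have "1 mod int n \<in> verts (circulant n S)" "0 \<in> verts (circulant n S)"
    using \<open>n > 0\<close> by (simp_all add: circulant_def carrier_integer_mod_group)
  then have "0 \<rightarrow>\<^sup>*\<^bsub>?G\<^esub> (1 mod int n)"
    using conn by (simp add: Digraph_Component.connected_def strongly_connected_def)
  then have "int n dvd r * (1 mod int n)"
    unfolding reachable_def
  proof (induction rule: rtrancl_on_induct)
    case (step y z)
    then have "int n dvd r * y + r * (z - y)"
      using parc by (intro dvd_add) auto
    then show ?case
      by (simp add: algebra_simps)
  qed simp
  then show ?thesis
    by (simp add: dvd_eq_mod_eq_0 mod_mult_right_eq)
qed

section \<open>The two implications\<close>

lemma normal_arc_transitive_imp_ord: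
  assumes "n > 0" and S: "S \<subseteq> carrier (integer_mod_group n)"
    and conn: "Digraph_Component.connected (circulant n S)"
    and norm: "normal_arc_transitive n S" and "s \<in> S"
  shows "group.ord (integer_mod_group n) s = n"
proof -
  let ?Z = "integer_mod_group n"
  define r where "r = group.ord ?Z s"
  have s: "s \<in> carrier ?Z"
    using S \<open>s \<in> S\<close> by auto
  have r: "s [^]\<^bsub>?Z\<^esub> r = \<one>\<^bsub>?Z\<^esub>"
    unfolding r_def by (rule group.pow_ord_eq_1[OF group_integer_mod_group s])
  \<comment> \<open>Some automorphism sends \<open>s\<close> to \<open>t\<close>, so the order
    \<open>r\<close> of \<open>s\<close> annihilates \<open>t\<close> as well.\<close>
  have "int n dvd int r * t" if "t \<in> S" for t
  proof -
    obtain \<sigma> where \<sigma>: "\<sigma> \<in> hom ?Z ?Z" "\<sigma> s = t"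
      using norm \<open>s \<in> S\<close> \<open>t \<in> S\<close>
      unfolding normal_arc_transitive_def auto_stabilizing_def auto_def by blast
    have "t [^]\<^bsub>?Z\<^esub> r = \<sigma> (s [^]\<^bsub>?Z\<^esub> r)"
      using hom_nat_pow[OF \<sigma>(1) s] \<sigma>(2) by simp
    also have "\<dots> = \<one>\<^bsub>?Z\<^esub>"
      unfolding r using hom_one[OF \<sigma>(1)] by simp
    finally show ?thesis
      by (simp add: dvd_eq_mod_eq_0)
  qed
  then have "int n dvd int r"
    using connected_circulant_annihilator[OF \<open>n > 0\<close> conn] by blast
  moreover have "r dvd n"
    unfolding r_def by (subst group.pow_eq_id[OF group_integer_mod_group s, symmetric]) simp
  ultimately show ?thesis
    unfolding r_def by (simp add: dvd_antisym)
qed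

lemma ord_imp_normal_arc_transitive:
  assumes "n > 0" and S: "S \<subseteq> carrier (integer_mod_group n) - {\<one>\<^bsub>integer_mod_group n\<^esub>}"
    and trans: "arc_transitive (circulant n S)"
    and ord: "\<forall>s \<in> S. group.ord (integer_mod_group n) s = n"
  shows "normal_arc_transitive n S"
  unfolding normal_arc_transitive_def
proof (intro ballI)
  fix s t assume st: "s \<in> S" "t \<in> S"
  let ?V = "{0..<int n}"
  have V: "carrier (integer_mod_group n) = ?V"
    using \<open>n > 0\<close> by (simp add: carrier_integer_mod_group)
  have SV: "S \<subseteq> ?V" and "0 \<notin> S"
    using S V by auto
  have cop: "coprime x (int n)" if "x \<in> S" for x
    using ord that SV V ord_integer_mod_group_eq_iff[OF \<open>n > 0\<close>, of x] by auto
  have modS: "x mod int n = x" if "x \<in> S" for x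
    using SV that by auto
  obtain i where i: "[s * i = 1] (mod int n)"
    using cong_solve_coprime_int[OF cop[OF st(1)]] by auto
  \<comment> \<open>Since \<open>i\<close> inverts \<open>s\<close>, this is \<open>t / s\<close>.
    Reducing modulo \<open>n\<close> before \<open>nat\<close> ensures that the integer is
    nonnegative.\<close>
  define m where "m = nat ((i * t) mod int n)"
  have m: "int m = (i * t) mod int n"
    using \<open>n > 0\<close> by (simp add: m_def)
  have "[int m * s = t] (mod int n)"
  proof -
    have "[int m * s = (s * i) * t] (mod int n)"
      by (simp add: m cong_def mod_mult_left_eq mult.commute mult.left_commute mod_mult_right_eq)
    also have "[(s * i) * t = 1 * t] (mod int n)"
      using i by (rule cong_scalar_right)
    finally show ?thesis
      by simp
  qed
  then have ms: "(int m * s) mod int n = t"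
    using modS[OF st(2)] by (simp add: cong_def)
  have cop_m: "coprime (int m) (int n)"
  proof -
    have "coprime (int m * s) (int n)"
      using \<open>[int m * s = t] (mod int n)\<close> cop[OF st(2)] cong_imp_coprime cong_sym by blast
    then show ?thesis
      by simp
  qed
  \<comment> \<open>The multiplier 0 would give \<open>t = 0\<close>, which \<open>S\<close>
    excludes.\<close>
  have "m > 0"
    using ms st(2) \<open>0 \<notin> S\<close> by (cases "m = 0") auto
  let ?mS = "(\<lambda>x. (int m * x) mod int n) ` S"
  have "S \<subseteq> ?mS"
  proof
    fix u assume "u \<in> S"
    \<comment> \<open>Arc-transitivity is applied to the arcs \<open>(0, t)\<close> and
      \<open>(0, u)\<close>: the resulting \<open>f\<close> fixes 0 and sends \<open>t\<close> to
      \<open>u\<close>, so it carries membership in \<open>?mS\<close> from \<open>t\<close> to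
      \<open>u\<close>.\<close>
    have "(0, x) \<in> arcs (circulant n S)" if "x \<in> S" for x
      using that SV modS \<open>n > 0\<close> by (auto simp: arcs_circulant)
    then obtain f where f: "f \<in> Bij (verts (circulant n S))" "f 0 = 0" "f t = u"
      "\<forall>x \<in> verts (circulant n S). \<forall>y \<in> verts (circulant n S).
         (f x, f y) \<in> arcs (circulant n S) \<longleftrightarrow> (x, y) \<in> arcs (circulant n S)"
      using trans \<open>u \<in> S\<close> \<open>t \<in> S\<close> unfolding arc_transitive_circulant_iff by fastforce
    have verts: "verts (circulant n S) = ?V"
      by (simp add: circulant_def V)
    have bij: "bij_betw f ?V ?V"
      using f(1) by (simp add: Bij_def verts)
    then have "circulant_perm n S f"
      using f(4) bij_betwE[OF bij] by (simp add: circulant_perm_def verts arcs_circulant[OF \<open>n > 0\<close>])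
    then have "circulant_perm n ?mS f"
      using \<open>n > 0\<close> SV \<open>m > 0\<close> cop_m by (intro circulant_perm_mult) auto
    moreover have "0 \<in> ?V" "t \<in> ?V"
      using SV st(2) \<open>n > 0\<close> by auto
    ultimately have "(f t - f 0) mod int n \<in> ?mS \<longleftrightarrow> (t - 0) mod int n \<in> ?mS"
      unfolding circulant_perm_def by blast
    moreover have "t \<in> ?mS"
      using ms st(1) by force
    ultimately show "u \<in> ?mS"
      using f modS \<open>u \<in> S\<close> st(2) by simp
  qed
  moreover have "finite S"
    using SV finite_subset by blast
  \<comment> \<open>An image of the finite set \<open>S\<close> has no more elements than
    \<open>S\<close>, so the inclusion is an equality.\<close>
  ultimately have "?mS = S"
    by (metis card_image_le card_seteq finite_imageI)
  moreover have "(\<lambda>x \<in> ?V. (int m * x) mod int n) ` S = ?mS"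
    using SV by (intro image_cong) auto
  ultimately have "(\<lambda>x \<in> ?V. (int m * x) mod int n) \<in> auto_stabilizing (integer_mod_group n) S"
    using mult_mod_auto[OF \<open>n > 0\<close> cop_m] by (simp add: auto_stabilizing_def)
  moreover have "(\<lambda>x \<in> ?V. (int m * x) mod int n) s = t"
    using ms SV st(1) by auto
  ultimately show "\<exists>\<sigma> \<in> auto_stabilizing (integer_mod_group n) S. \<sigma> s = t"
    by blast
qed

theorem theorem1p1:
  fixes n :: nat and S :: "int set"
  assumes "n \<ge> 1"
    and "S \<subseteq> carrier (integer_mod_group n) - {\<one>\<^bsub>integer_mod_group n\<^esub>}"
    and "Digraph_Component.connected (circulant n S)"
    and "arc_transitive (circulant n S)"
  shows "normal_arc_transitive n S \<longleftrightarrow> (\<forall>s \<in> S. group.ord (integer_mod_group n) s = n)"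
  using assms normal_arc_transitive_imp_ord[of n S] ord_imp_normal_arc_transitive[of n S] by auto

end
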